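(* Let $n_1,n_2,v_1,v_2\in(0,1)$ and $\xi_1,\xi_2>0$ be real constants. There is a real number $\tilde C>0$, depending only on $n_1,n_2,v_1,v_2,\xi_1,\xi_2$, such that the following holds. Let $0\le k_1<1$, $k_2\ge 0$, $\omega_1,\omega_2<1$ be real constants, let $f_1,f_2$ be real-valued functions, and let $y,z$ be solutions on $[0,1]$ of $$-(t^{k_1}y'(t))'=t^{-\omega_1}f_1(t,y(t),z(t)),\qquad -(t^{k_2}z'(t))'=t^{-\omega_2}f_2(t,y(t),z(t)),\qquad t\in(0,1),$$ subject to the four point boundary conditions $y(0)=0$, $y(1)=n_1z(v_1)$, $z(0)=0$, $z(1)=n_2y(v_2)$. Assume that $y''',z'''\in L^2([0,1])$ are continuous functions on $[0,1]$ with $|y'''(t)|\le\xi_1$ and $|z'''(t)|\le\xi_2$ for all $t\in[0,1]$. Let $\epsilon>0$, let $J\ge 0$ be an integer, and put $M=2^J$. If $$J>\log_2\sqrt{\frac{2\tilde C}{\epsilon}}-1,$$ then $\|\overline E_M\|_2<\epsilon$, where $\|\overline E_M\|_2=\|\overline E_{M1}\|_2+\|\overline E_{M2}\|_2$, $\overline E_{M1}=y^M-y$, $\overline E_{M2}=z^M-z$, and $y^M,z^M$ are the truncated Haar wavelet solutions defined in the context.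
   Context: Haar functions on $[0,1]$. Let $h_1(x)=1$ for $0\le x\le 1$ and $h_1(x)=0$ otherwise. For $i\ge 2$ write $i=m+k+1$ with $m=2^j$, $j\ge 0$, $0\le k\le m-1$, and set $\eta_1(i)=k/m$, $\eta_2(i)=(k+\tfrac12)/m$, $\eta_3(i)=(k+1)/m$; then $h_i(x)=1$ for $\eta_1(i)\le x<\eta_2(i)$, $h_i(x)=-1$ for $\eta_2(i)\le x<\eta_3(i)$, and $h_i(x)=0$ otherwise. Let $P_{2,i}(x)=\int_0^x(x-t)h_i(t)\,dt$ (the twofold iterated integral of $h_i$ from $0$). Coefficients. $a_i$ and $b_i$ are the Haar coefficients of $y''$ and $z''$: $a_1=\int_0^1y''(t)\,dt$, $b_1=\int_0^1z''(t)\,dt$, and for $i=2^j+k+1\ge 2$, $a_i=2^j\int_0^1y''(t)h_i(t)\,dt$, $b_i=2^j\int_0^1z''(t)h_i(t)\,dt$. Truncated solutions. With $M=2^J$, $$y^M(t)=\frac{n_1t}{1-n_1n_2v_1v_2}\left[n_2v_1\sum_{i=1}^{2M}a_i\bigl[P_{2,i}(v_2)-v_2P_{2,i}(1)\bigr]+\sum_{i=1}^{2M}b_i\bigl[P_{2,i}(v_1)-v_1P_{2,i}(1)\bigr]\right]+\sum_{i=1}^{2M}a_i\bigl[P_{2,i}(t)-tP_{2,i}(1)\bigr],$$ $$z^M(t)=\frac{n_2t}{1-n_1n_2v_1v_2}\left[\sum_{i=1}^{2M}a_i\bigl[P_{2,i}(v_2)-v_2P_{2,i}(1)\bigr]+v_2n_1\sum_{i=1}^{2M}b_i\bigl[P_{2,i}(v_1)-v_1P_{2,i}(1)\bigr]\right]+\sum_{i=1}^{2M}b_i\bigl[P_{2,i}(t)-tP_{2,i}(1)\bigr].$$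 The exact solutions $y,z$ are given by the same formulas with every sum $\sum_{i=1}^{2M}$ replaced by $\sum_{i=1}^{\infty}$, so that $|\overline E_{M1}|$ and $|\overline E_{M2}|$ are the absolute values of the same expressions with every sum replaced by the tail sum over $i=2^j+k+1$, $j\ge J+1$, $0\le k\le 2^j-1$. $\|\cdot\|_2$ is the $L^2([0,1])$ norm. *)

theory Defs
  imports "HOL-Analysis.Analysis" "HOL-Library.Discrete_Functions"
begin

text \<open>
  For \<open>i \<ge> 2\<close> the decomposition \<open>i = 2 ^ j + k + 1\<close> with \<open>k < 2 ^ j\<close> is unique
  (lemma \<open>haar_index\<close> below): \<open>j\<close> is the integer binary logarithm of \<open>i - 1\<close>.
\<close>

definition haar_level :: "nat \<Rightarrow> nat" where
  "haar_level i = floor_log (i - 1)"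

definition haar_shift :: "nat \<Rightarrow> nat" where
  "haar_shift i = i - 1 - 2 ^ haar_level i"

lemma haar_index:
  assumes "k < 2 ^ j"
  shows "haar_level (2 ^ j + k + 1) = j" "haar_shift (2 ^ j + k + 1) = k"
proof -
  show "haar_level (2 ^ j + k + 1) = j"
    unfolding haar_level_def by (rule floor_log_eqI) (use assms in auto)
  then show "haar_shift (2 ^ j + k + 1) = k"
    by (simp add: haar_shift_def)
qed

lemma haar_index_decomp:
  assumes "i \<ge> 2"
  shows "i = 2 ^ haar_level i + haar_shift i + 1" "haar_shift i < 2 ^ haar_level i"
proof -
  have "2 ^ haar_level i \<le> i - 1" "i - 1 < 2 * 2 ^ haar_level i"
    using assms floor_log_exp2_le[of "i - 1"] floor_log_exp2_gt[of "i - 1"]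
    by (auto simp: haar_level_def)
  then show "i = 2 ^ haar_level i + haar_shift i + 1" "haar_shift i < 2 ^ haar_level i"
    using assms by (auto simp: haar_shift_def)
qed

definition haar_eta1 :: "nat \<Rightarrow> real" where
  "haar_eta1 i = real (haar_shift i) / 2 ^ haar_level i"

definition haar_eta2 :: "nat \<Rightarrow> real" where
  "haar_eta2 i = (real (haar_shift i) + 1 / 2) / 2 ^ haar_level i"

definition haar_eta3 :: "nat \<Rightarrow> real" where
  "haar_eta3 i = (real (haar_shift i) + 1) / 2 ^ haar_level i"

text \<open>The index starts at 1; the value at \<open>i = 0\<close> is irrelevant.\<close>

definition haar :: "nat \<Rightarrow> real \<Rightarrow> real" where
  "haar i x =
    (if i = 1 then (if 0 \<le> x \<and> x \<le> 1 then 1 else 0)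
     else if haar_eta1 i \<le> x \<and> x < haar_eta2 i then 1
     else if haar_eta2 i \<le> x \<and> x < haar_eta3 i then - 1
     else 0)"

text \<open>Only used for \<open>x \<in> {0..1}\<close>.\<close>

definition haar_P2 :: "nat \<Rightarrow> real \<Rightarrow> real" where
  "haar_P2 i x = (LBINT t:{0..x}. (x - t) * haar i t)"

definition haar_coeff :: "(real \<Rightarrow> real) \<Rightarrow> nat \<Rightarrow> real" where
  "haar_coeff g i =
    (if i = 1 then (LBINT t:{0..1}. g t)
     else 2 ^ haar_level i * (LBINT t:{0..1}. g t * haar i t))"

definition haar_sum :: "(real \<Rightarrow> real) \<Rightarrow> nat \<Rightarrow> real \<Rightarrow> real" where
  "haar_sum g M t = (\<Sum>i=1..2 * M. haar_coeff g i * (haar_P2 i t - t * haar_P2 i 1))"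

text \<open>
  The truncated solutions; the arguments \<open>y2\<close> and \<open>z2\<close> stand for the second derivatives
  \<open>y''\<close> and \<open>z''\<close>.
\<close>

definition truncated_y ::
  "real \<Rightarrow> real \<Rightarrow> real \<Rightarrow> real \<Rightarrow> (real \<Rightarrow> real) \<Rightarrow> (real \<Rightarrow> real) \<Rightarrow> nat \<Rightarrow> real \<Rightarrow> real" where
  "truncated_y n1 n2 v1 v2 y2 z2 M t =
    n1 * t / (1 - n1 * n2 * v1 * v2) * (n2 * v1 * haar_sum y2 M v2 + haar_sum z2 M v1)
    + haar_sum y2 M t"

definition truncated_z ::
  "real \<Rightarrow> real \<Rightarrow> real \<Rightarrow> real \<Rightarrow> (real \<Rightarrow> real) \<Rightarrow> (real \<Rightarrow> real) \<Rightarrow> nat \<Rightarrow> real \<Rightarrow> real" where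
  "truncated_z n1 n2 v1 v2 y2 z2 M t =
    n2 * t / (1 - n1 * n2 * v1 * v2) * (haar_sum y2 M v2 + v2 * n1 * haar_sum z2 M v1)
    + haar_sum z2 M t"

definition in_L2_01 :: "(real \<Rightarrow> real) \<Rightarrow> bool" where
  "in_L2_01 f \<longleftrightarrow>
    set_borel_measurable lborel {0..1} f \<and> set_integrable lborel {0..1} (\<lambda>t. (f t)\<^sup>2)"

definition L2_norm_01 :: "(real \<Rightarrow> real) \<Rightarrow> real" where
  "L2_norm_01 f = sqrt (LBINT t:{0..1}. (f t)\<^sup>2)"

text \<open>\<open>f'\<close> is the derivative of \<open>f\<close> on \<open>[0,1]\<close>, one-sided at the end points.\<close>

definition deriv_on_01 :: "(real \<Rightarrow> real) \<Rightarrow> (real \<Rightarrow> real) \<Rightarrow> bool" where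
  "deriv_on_01 f f' \<longleftrightarrow> (\<forall>t\<in>{0..1}. (f has_real_derivative f' t) (at t within {0..1}))"

text \<open>
  The equation \<open>-(t\<^sup>k u'(t))' = t\<^sup>-\<^sup>w F(t)\<close> on \<open>(0,1)\<close>, where \<open>u1\<close> stands for \<open>u'\<close>.
\<close>

definition lane_emden_on ::
  "real \<Rightarrow> real \<Rightarrow> (real \<Rightarrow> real) \<Rightarrow> (real \<Rightarrow> real) \<Rightarrow> bool" where
  "lane_emden_on k w F u1 \<longleftrightarrow>
    (\<forall>t\<in>{0<..<1}. ((\<lambda>s. s powr k * u1 s) has_real_derivative - (t powr (- w) * F t)) (at t))"

definition four_point_bc ::
  "real \<Rightarrow> real \<Rightarrow> real \<Rightarrow> real \<Rightarrow> (real \<Rightarrow> real) \<Rightarrow> (real \<Rightarrow> real) \<Rightarrow> bool" where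
  "four_point_bc n1 n2 v1 v2 y z \<longleftrightarrow>
    y 0 = 0 \<and> y 1 = n1 * z v1 \<and> z 0 = 0 \<and> z 1 = n2 * y v2"

end

theory Submission
  imports Defs
begin

text \<open>
  The boundary conditions couple \<open>y\<close> and \<open>z\<close> only through the values \<open>y 1\<close> and \<open>z 1\<close>, and they
  determine these two numbers linearly from \<open>A t = y t - t * y 1\<close> at \<open>v2\<close> and \<open>B t = z t - t * z 1\<close>
  at \<open>v1\<close> (lemma \<open>four_point_boundary_values\<close>). The truncated solutions arise from the same linear
  formulas with \<open>A\<close> and \<open>B\<close> replaced by the truncated Haar sums. Hence it suffices to show that a
  truncated Haar sum differs from \<open>A\<close> (or \<open>B\<close>) by at most \<open>h\<^sup>2\<close> times the bound on the third
  derivative, uniformly in \<open>t\<close>, where \<open>h = 1 / (2 * M)\<close>; an \<open>L\<^sup>2\<close> norm over \<open>[0,1]\<close> is at most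
  the supremum.

  Both objects to be compared are integrals against Green's function \<open>green t\<close> of the
  operator \<open>u''\<close> with Dirichlet conditions. On the one hand
  \<open>u t - t * u 1 = \<integral> green t s * u'' s ds\<close>. On the other hand
  \<open>haar_P2 i t - t * haar_P2 i 1\<close> is the \<open>i\<close>-th Haar moment of \<open>green t\<close>. The truncated sum is therefore
  a bilinear form \<open>\<Sum>i. haar_coeff g i * \<integral> w * haar i\<close> in \<open>g = u''\<close> and \<open>w = green t\<close>. By induction on
  the level this form equals \<open>\<Sum>Q. (\<integral>\<^sub>Q g) * (\<integral>\<^sub>Q w) / h\<close>, the sum being over the dyadic cells
  \<open>Q\<close> of length \<open>h\<close> (lemma \<open>sum_haar_dyadic\<close>): the truncated Haar expansion replaces \<open>g\<close> by its
  cell averages.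

  On one cell the difference from \<open>\<integral>\<^sub>Q w * g\<close> is \<open>h\<close> times a covariance of two Lipschitz functions,
  each of which oscillates by \<open>O(h)\<close>, and so it is \<open>O(h\<^sup>3)\<close>
  (lemma \<open>dyadic_cell_covariance_bound\<close>). Summing over the \<open>1 / h\<close> cells gives \<open>O(h\<^sup>2)\<close>, because
  \<open>u''\<close> is Lipschitz by the bound on \<open>u'''\<close> and \<open>green t\<close> is Lipschitz with constant 1.
\<close>

section \<open>Dyadic cells\<close>

definition dyadic_cell :: "nat \<Rightarrow> nat \<Rightarrow> real set" where
  "dyadic_cell n k = {real k / 2 ^ n..(real k + 1) / 2 ^ n}"

lemma dyadic_cell_subset:
  assumes "k < 2 ^ n"
  shows "dyadic_cell n k \<subseteq> {0..1}"
proof -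
  have "real k + 1 \<le> 2 ^ n"
    using assms by (metis Suc_leI of_nat_Suc of_nat_le_iff of_nat_numeral of_nat_power add.commute)
  then show ?thesis
    by (auto simp: dyadic_cell_def divide_simps dest: order_trans)
qed

lemma integrable_on_dyadic_cell:
  fixes f :: "real \<Rightarrow> real"
  assumes "continuous_on {0..1} f" "k < 2 ^ n"
  shows "f integrable_on dyadic_cell n k"
  using continuous_on_subset[OF assms(1) dyadic_cell_subset[OF assms(2)]]
  unfolding dyadic_cell_def by (rule integrable_continuous_interval)

lemma integral_eq_sum_dyadic_cells:
  fixes f :: "real \<Rightarrow> real"
  assumes "continuous_on {0..1} f"
  shows "integral {0..1} f = (\<Sum>k<2 ^ n. integral (dyadic_cell n k) f)"
proof -
  have "integral {0..real m / 2 ^ n} f = (\<Sum>k<m. integral (dyadic_cell n k) f)"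
    if "m \<le> 2 ^ n" for m
    using that
  proof (induction m)
    case (Suc m)
    have "real m + 1 \<le> 2 ^ n"
      using Suc.prems by (metis of_nat_Suc of_nat_le_iff of_nat_numeral of_nat_power add.commute)
    then have "f integrable_on {0..(real m + 1) / 2 ^ n}"
      by (intro integrable_continuous_interval continuous_on_subset[OF assms]) auto
    then have "integral {0..real m / 2 ^ n} f + integral (dyadic_cell n m) f
        = integral {0..(real m + 1) / 2 ^ n} f"
      unfolding dyadic_cell_def by (intro Henstock_Kurzweil_Integration.integral_combine) (auto simp: divide_simps)
    with Suc show ?case
      by (simp add: add.commute)
  qed auto
  from this[of "2 ^ n"] show ?thesis
    by simp
qed

lemma integral_dyadic_cell_split:
  fixes f :: "real \<Rightarrow> real"
  assumes "continuous_on {0..1} f" "k < 2 ^ n"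
  shows "integral (dyadic_cell n k) f
    = integral (dyadic_cell (Suc n) (2 * k)) f + integral (dyadic_cell (Suc n) (2 * k + 1)) f"
proof -
  have cells: "dyadic_cell (Suc n) (2 * k) = {real k / 2 ^ n..(real k + 1 / 2) / 2 ^ n}"
    "dyadic_cell (Suc n) (2 * k + 1) = {(real k + 1 / 2) / 2 ^ n..(real k + 1) / 2 ^ n}"
    by (auto simp: dyadic_cell_def field_simps)
  show ?thesis
    unfolding cells using integrable_on_dyadic_cell[OF assms]
    unfolding dyadic_cell_def
    by (intro Henstock_Kurzweil_Integration.integral_combine[symmetric]) (auto simp: divide_simps)
qed

lemma sum_lessThan_double:
  fixes f :: "nat \<Rightarrow> real"
  shows "(\<Sum>k<2 * m. f k) = (\<Sum>k<m. f (2 * k) + f (2 * k + 1))"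
  by (induction m) auto

section \<open>Haar moments\<close>

lemma set_lborel_integral_Ico:
  fixes f :: "real \<Rightarrow> real"
  assumes "continuous_on {a..b} f"
  shows "set_integrable lborel {a..<b} f" "(LBINT t:{a..<b}. f t) = integral {a..b} f"
proof -
  show int: "set_integrable lborel {a..<b} f"
    by (rule set_integrable_subset[OF borel_integrable_atLeastAtMost'[OF assms]]) auto
  have "(LBINT t:{a..<b}. f t) = integral {a..<b} f"
    using int by (rule set_borel_integral_eq_integral)
  also have "\<dots> = integral {a..b} f"
    by (rule integral_spike_set; rule negligible_subset[of "{b}"]) auto
  finally show "(LBINT t:{a..<b}. f t) = integral {a..b} f" .
qed

text \<open>
  The two halves of the support of a Haar function of level \<open>j\<close> are sibling dyadic cells of level
  \<open>j + 1\<close>. This also turns the Lebesgue moments of the problem into integrals over compact intervals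
  of continuous functions.
\<close>

lemma set_integral_mult_haar:
  fixes w :: "real \<Rightarrow> real"
  assumes w: "continuous_on {0..1} w" and k: "k < 2 ^ j"
  shows "set_integrable lborel {0..1} (\<lambda>t. w t * haar (2 ^ j + k + 1) t)"
    and "(LBINT t:{0..1}. w t * haar (2 ^ j + k + 1) t)
      = integral (dyadic_cell (Suc j) (2 * k)) w - integral (dyadic_cell (Suc j) (2 * k + 1)) w"
proof -
  define i where "i = 2 ^ j + k + 1"
  define a b c where "a = real k / 2 ^ j" and "b = (real k + 1 / 2) / 2 ^ j"
    and "c = (real k + 1) / 2 ^ j"
  have cells: "dyadic_cell (Suc j) (2 * k) = {a..b}" "dyadic_cell (Suc j) (2 * k + 1) = {b..c}"
    by (auto simp: dyadic_cell_def a_def b_def c_def field_simps)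
  have sub: "{a..c} \<subseteq> {0..1}"
    using dyadic_cell_subset[OF k] by (simp add: dyadic_cell_def a_def c_def)
  have abc: "a < b" "b < c"
    by (auto simp: a_def b_def c_def divide_simps)
  have eta: "haar_eta1 i = a" "haar_eta2 i = b" "haar_eta3 i = c" and i: "i \<noteq> 1"
    using haar_index[OF k]
    by (auto simp: haar_eta1_def haar_eta2_def haar_eta3_def a_def b_def c_def i_def)
  have eq: "indicat_real {0..1} t *\<^sub>R (w t * haar i t)
      = indicat_real {a..<b} t *\<^sub>R w t - indicat_real {b..<c} t *\<^sub>R w t" for t
    using abc sub i unfolding haar_def eta
    by (auto simp: indicator_def subset_iff)
  have cont: "continuous_on {a..b} w" "continuous_on {b..c} w"
    using abc sub by (auto intro!: continuous_on_subset[OF w])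
  note L = set_lborel_integral_Ico[OF cont(1)] and R = set_lborel_integral_Ico[OF cont(2)]
  show "set_integrable lborel {0..1} (\<lambda>t. w t * haar (2 ^ j + k + 1) t)"
    using L(1) R(1) unfolding i_def[symmetric] set_integrable_def eq
    by (rule Bochner_Integration.integrable_diff)
  show "(LBINT t:{0..1}. w t * haar (2 ^ j + k + 1) t)
      = integral (dyadic_cell (Suc j) (2 * k)) w - integral (dyadic_cell (Suc j) (2 * k + 1)) w"
    using L R unfolding i_def[symmetric] set_lebesgue_integral_def set_integrable_def eq cells
    by simp
qed

lemma set_integral_mult_haar_1:
  fixes w :: "real \<Rightarrow> real"
  assumes w: "continuous_on {0..1} w"
  shows "set_integrable lborel {0..1} (\<lambda>t. w t * haar 1 t)"
    and "(LBINT t:{0..1}. w t * haar 1 t) = integral {0..1} w"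
proof -
  have eq: "indicat_real {0..1} t *\<^sub>R (w t * haar 1 t) = indicat_real {0..1} t *\<^sub>R w t" for t
    by (auto simp: haar_def indicator_def)
  have int: "set_integrable lborel {0..1} w"
    using w by (rule borel_integrable_atLeastAtMost')
  then show "set_integrable lborel {0..1} (\<lambda>t. w t * haar 1 t)"
    unfolding set_integrable_def eq .
  show "(LBINT t:{0..1}. w t * haar 1 t) = integral {0..1} w"
    using set_borel_integral_eq_integral(2)[OF int]
    unfolding set_lebesgue_integral_def eq .
qed

lemma set_integrable_mult_haar:
  fixes w :: "real \<Rightarrow> real"
  assumes "continuous_on {0..1} w" "i \<ge> 1"
  shows "set_integrable lborel {0..1} (\<lambda>t. w t * haar i t)"
proof (cases "i = 1")
  case False
  with assms(2) haar_index_decomp[of i] set_integral_mult_haar(1)[OF assms(1)] show ?thesis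
    by (metis One_nat_def Suc_1 Suc_leI le_neq_implies_less)
qed (use set_integral_mult_haar_1(1)[OF assms(1)] in simp)

section \<open>Partial sums of the Haar expansion\<close>

text \<open>
  In the induction step a parent cell has integrals \<open>a + b\<close> of \<open>g\<close> and \<open>c + d\<close> of \<open>w\<close>, where \<open>a\<close>, \<open>b\<close>
  and \<open>c\<close>, \<open>d\<close> belong to its two children, and the Haar function living on it contributes
  the product of \<open>a - b\<close> and \<open>c - d\<close>. The identity
  \<open>(a + b) * (c + d) + (a - b) * (c - d) = 2 * (a * c + b * d)\<close> passes to the next level.
\<close>

lemma sum_haar_dyadic:
  fixes g w :: "real \<Rightarrow> real"
  assumes g: "continuous_on {0..1} g" and w: "continuous_on {0..1} w"
  shows "(\<Sum>i=1..2 ^ n. haar_coeff g i * (LBINT t:{0..1}. w t * haar i t))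
    = (\<Sum>k<2 ^ n. 2 ^ n * integral (dyadic_cell n k) g * integral (dyadic_cell n k) w)"
proof (induction n)
  case 0
  have "haar_coeff g 1 = integral {0..1} g"
    using set_borel_integral_eq_integral(2)[OF borel_integrable_atLeastAtMost'[OF g]]
    by (simp add: haar_coeff_def)
  then show ?case
    using set_integral_mult_haar_1(2)[OF w] by (simp add: dyadic_cell_def)
next
  case (Suc n)
  let ?F = "\<lambda>i. haar_coeff g i * (LBINT t:{0..1}. w t * haar i t)"
  let ?G = "\<lambda>n k. integral (dyadic_cell n k) g" and ?W = "\<lambda>n k. integral (dyadic_cell n k) w"
  have new: "?F (2 ^ n + k + 1) = 2 ^ n * (?G (Suc n) (2 * k) - ?G (Suc n) (2 * k + 1))
      * (?W (Suc n) (2 * k) - ?W (Suc n) (2 * k + 1))" if "k < 2 ^ n" for k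
    using that set_integral_mult_haar(2)[OF g that] set_integral_mult_haar(2)[OF w that]
      haar_index(1)[OF that]
    by (simp add: haar_coeff_def)
  have "(\<Sum>i=1..2 ^ Suc n. ?F i) = (\<Sum>i=1..2 ^ n. ?F i) + (\<Sum>i=2 ^ n + 1..2 ^ n + 2 ^ n. ?F i)"
    using sum.ub_add_nat[of 1 "2 ^ n" ?F "2 ^ n"] by (simp add: mult_2)
  \<comment> \<open>The new indices are exactly those of level \<open>n\<close>, one for each cell of level \<open>n\<close>.\<close>
  also have "(\<Sum>i=2 ^ n + 1..2 ^ n + 2 ^ n. ?F i) = (\<Sum>k<2 ^ n. ?F (2 ^ n + k + 1))"
    by (rule sum.reindex_bij_witness[of _ "\<lambda>k. 2 ^ n + k + 1" "\<lambda>i. i - 2 ^ n - 1"]) auto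
  also have "(\<Sum>i=1..2 ^ n. ?F i) + \<dots>
      = (\<Sum>k<2 ^ n. 2 ^ n * ?G n k * ?W n k + ?F (2 ^ n + k + 1))"
    by (simp only: Suc.IH sum.distrib)
  also have "\<dots> = (\<Sum>k<2 ^ n. 2 ^ Suc n * ?G (Suc n) (2 * k) * ?W (Suc n) (2 * k)
      + 2 ^ Suc n * ?G (Suc n) (2 * k + 1) * ?W (Suc n) (2 * k + 1))"
  proof (rule sum.cong)
    fix k :: nat
    assume "k \<in> {..<2 ^ n}"
    then have k: "k < 2 ^ n"
      by simp
    show "2 ^ n * ?G n k * ?W n k + ?F (2 ^ n + k + 1)
      = 2 ^ Suc n * ?G (Suc n) (2 * k) * ?W (Suc n) (2 * k)
      + 2 ^ Suc n * ?G (Suc n) (2 * k + 1) * ?W (Suc n) (2 * k + 1)"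
      unfolding new[OF k] integral_dyadic_cell_split[OF g k] integral_dyadic_cell_split[OF w k]
      by (simp add: algebra_simps)
  qed simp
  also have "\<dots> = (\<Sum>k<2 ^ Suc n. 2 ^ Suc n * ?G (Suc n) k * ?W (Suc n) k)"
    using sum_lessThan_double[of "\<lambda>k. 2 ^ Suc n * ?G (Suc n) k * ?W (Suc n) k" "2 ^ n"]
    by simp
  finally show ?case .
qed

text \<open>
  With \<open>c\<close> the average of \<open>g\<close> over the cell, \<open>g - c\<close> integrates to zero there, so any constant may be
  subtracted from \<open>w\<close> in the integral of \<open>(g - c) * w\<close>. Subtracting the value of \<open>w\<close> at the left end
  point makes both factors of the order of the cell length \<open>h\<close>, and integrating over the
  cell supplies the third factor \<open>h\<close>.
\<close>

lemma dyadic_cell_covariance_bound: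
  fixes g w :: "real \<Rightarrow> real"
  assumes g: "A-lipschitz_on {0..1} g" and w: "B-lipschitz_on {0..1} w" and k: "k < 2 ^ n"
  shows "\<bar>2 ^ n * integral (dyadic_cell n k) g * integral (dyadic_cell n k) w
      - integral (dyadic_cell n k) (\<lambda>s. w s * g s)\<bar> \<le> A * B / (2 ^ n) ^ 3"
proof -
  define h :: real where "h = 1 / 2 ^ n"
  define Q where "Q = dyadic_cell n k"
  define c where "c = integral Q g / h"
  define a where "a = real k / 2 ^ n"
  have h: "h > 0"
    by (simp add: h_def)
  have Q: "Q = {a..a + h}"
    by (simp add: Q_def dyadic_cell_def a_def h_def add_divide_distrib)
  have sub: "Q \<subseteq> {0..1}"
    using dyadic_cell_subset[OF k] by (simp add: Q_def)
  have AB: "A \<ge> 0" "B \<ge> 0"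
    using g w by (auto dest: lipschitz_on_nonneg)
  have cg: "continuous_on Q g" and cw: "continuous_on Q w"
    using lipschitz_on_continuous_on[OF g] lipschitz_on_continuous_on[OF w] sub
    by (auto intro: continuous_on_subset)
  have int: "f integrable_on Q" if "continuous_on Q f" for f :: "real \<Rightarrow> real"
    using that unfolding Q by (rule integrable_continuous_interval)
  have lip: "\<bar>f s - f t\<bar> \<le> L * h"
    if "L-lipschitz_on {0..1} f" "s \<in> Q" "t \<in> Q" for f :: "real \<Rightarrow> real" and L s t
  proof -
    have "\<bar>f s - f t\<bar> \<le> L * \<bar>s - t\<bar>"
      using lipschitz_onD[OF that(1) subsetD[OF sub that(2)] subsetD[OF sub that(3)]]
      by (simp add: dist_real_def)
    also have "\<dots> \<le> L * h"
      using that lipschitz_on_nonneg[OF that(1)] by (intro mult_left_mono) (auto simp: Q)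
    finally show ?thesis .
  qed
  have avg: "\<bar>g s - c\<bar> \<le> A * h" if s: "s \<in> Q" for s
  proof -
    have "norm (integral Q (\<lambda>t. g s - g t)) \<le> A * h * (a + h - a)"
      unfolding Q
      by (rule integral_bound) (use h lip[OF g s] cg in \<open>auto simp: Q intro!: continuous_intros\<close>)
    moreover have "integral Q (\<lambda>t. g s - g t) = h * (g s - c)"
      using int[OF cg] h by (subst Henstock_Kurzweil_Integration.integral_diff)
        (auto simp: c_def Q algebra_simps)
    ultimately show ?thesis
      using h by (simp add: abs_mult mult.commute)
  qed
  have "norm (integral Q (\<lambda>s. (g s - c) * (w s - w a))) \<le> (A * h) * (B * h) * (a + h - a)"
    unfolding Q
  proof (rule integral_bound)
    show "norm ((g s - c) * (w s - w a)) \<le> (A * h) * (B * h)" if "s \<in> {a..a + h}" for s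
      unfolding real_norm_def abs_mult
      using avg[of s] lip[OF w, of s a] that h AB by (intro mult_mono) (auto simp: Q)
  qed (use h cg cw in \<open>auto simp: Q intro!: continuous_intros\<close>)
  moreover have "integral Q (\<lambda>s. (g s - c) * (w s - w a))
      = integral Q (\<lambda>s. w s * g s) - integral Q g * integral Q w / h"
  proof -
    have const: "((\<lambda>s. c * w a) has_integral h * (c * w a)) Q"
      using has_integral_const_real[of "c * w a" a "a + h"] h by (simp add: Q)
    have "((\<lambda>s. ((w s * g s - c * w s) - w a * g s) + c * w a) has_integral
        (integral Q (\<lambda>s. w s * g s) - c * integral Q w - w a * integral Q g) + h * (c * w a)) Q"
      using cg cw
      by (intro has_integral_add has_integral_diff has_integral_mult_right const
          integrable_integral int continuous_intros)
    then have "((\<lambda>s. (g s - c) * (w s - w a)) has_integral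
        (integral Q (\<lambda>s. w s * g s) - c * integral Q w - w a * integral Q g) + h * (c * w a)) Q"
      by (rule has_integral_eq[rotated]) (simp add: algebra_simps)
    then have "integral Q (\<lambda>s. (g s - c) * (w s - w a))
        = (integral Q (\<lambda>s. w s * g s) - c * integral Q w - w a * integral Q g) + h * (c * w a)"
      by (rule integral_unique)
    also have "\<dots> = integral Q (\<lambda>s. w s * g s) - integral Q g * integral Q w / h"
      using h by (simp add: c_def)
    finally show ?thesis .
  qed
  ultimately have "\<bar>integral Q (\<lambda>s. w s * g s) - integral Q g * integral Q w / h\<bar> \<le> A * B * h ^ 3"
    by (simp add: power3_eq_cube ac_simps)
  then show ?thesis
    by (simp add: Q_def[symmetric] h_def abs_minus_commute power_one_over ac_simps)
qed

lemma sum_haar_error: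
  fixes g w :: "real \<Rightarrow> real"
  assumes g: "A-lipschitz_on {0..1} g" and w: "B-lipschitz_on {0..1} w"
  shows "\<bar>(\<Sum>i=1..2 ^ n. haar_coeff g i * (LBINT t:{0..1}. w t * haar i t))
      - integral {0..1} (\<lambda>s. w s * g s)\<bar> \<le> A * B / (2 ^ n)\<^sup>2"
proof -
  let ?d = "\<lambda>k. 2 ^ n * integral (dyadic_cell n k) g * integral (dyadic_cell n k) w
      - integral (dyadic_cell n k) (\<lambda>s. w s * g s)"
  have c: "continuous_on {0..1} g" "continuous_on {0..1} w"
    using g w by (auto intro: lipschitz_on_continuous_on)
  have "(\<Sum>i=1..2 ^ n. haar_coeff g i * (LBINT t:{0..1}. w t * haar i t))
      - integral {0..1} (\<lambda>s. w s * g s) = (\<Sum>k<2 ^ n. ?d k)"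
    unfolding sum_haar_dyadic[OF c] sum_subtractf
    using c by (subst integral_eq_sum_dyadic_cells[of _ n]) (auto intro!: continuous_intros)
  also have "\<bar>\<dots>\<bar> \<le> (\<Sum>k<(2::nat) ^ n. A * B / (2 ^ n) ^ 3)"
    using dyadic_cell_covariance_bound[OF g w] by (intro order_trans[OF sum_abs] sum_mono) auto
  also have "\<dots> = A * B / (2 ^ n)\<^sup>2"
    by (simp add: power3_eq_cube power2_eq_square)
  finally show ?thesis .
qed

section \<open>Green's function\<close>

text \<open>
  For \<open>s \<le> t\<close> this is \<open>(t - 1) * s\<close>, for \<open>s \<ge> t\<close> it is \<open>t * (s - 1)\<close>: the usual Green's
  function of \<open>u'' = f\<close>, \<open>u 0 = u 1 = 0\<close>. The form with \<open>max\<close> keeps apart the kernel of the twofold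
  integral from \<open>0\<close> and the linear correction, which is how it arises from \<open>haar_P2\<close>.
\<close>

definition green :: "real \<Rightarrow> real \<Rightarrow> real" where
  "green t s = max 0 (t - s) - t * (1 - s)"

lemma green_lipschitz:
  assumes "t \<in> {0..1}"
  shows "1-lipschitz_on {0..1} (green t)"
proof (rule lipschitz_onI)
  fix x y :: real
  have "\<bar>green t x - green t y\<bar> \<le> \<bar>x - y\<bar>" if "x \<le> y" for x y
  proof -
    have "0 \<le> t * (y - x)" "t * (y - x) \<le> y - x"
      using assms that mult_left_le_one_le[of "y - x" t] by auto
    moreover have "green t x - green t y = (max 0 (t - x) - max 0 (t - y)) - t * (y - x)"
      by (simp add: green_def algebra_simps)
    moreover have "0 \<le> max 0 (t - x) - max 0 (t - y)" "max 0 (t - x) - max 0 (t - y) \<le> y - x"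
      using that by auto
    ultimately show ?thesis
      using that by linarith
  qed
  from this[of x y] this[of y x] show "dist (green t x) (green t y) \<le> 1 * dist x y"
    by (cases "x \<le> y") (auto simp: dist_real_def abs_minus_commute)
qed simp

lemma haar_P2_eq_green:
  assumes t: "t \<in> {0..1}" and i: "i \<ge> 1"
  shows "haar_P2 i t - t * haar_P2 i 1 = (LBINT s:{0..1}. green t s * haar i s)"
proof -
  have P: "haar_P2 i u = (LBINT s:{0..1}. max 0 (u - s) * haar i s)" if "u \<in> {0..1}" for u
    unfolding haar_P2_def set_lebesgue_integral_def
    by (rule Bochner_Integration.integral_cong) (use that in \<open>auto simp: indicator_def\<close>)
  have int: "set_integrable lborel {0..1} (\<lambda>s. max 0 (u - s) * haar i s)" for u
    by (rule set_integrable_mult_haar[OF _ i]) (intro continuous_intros)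
  have "haar_P2 i t - t * haar_P2 i 1
      = (LBINT s:{0..1}. max 0 (t - s) * haar i s - t * (max 0 (1 - s) * haar i s))"
    using t int[of t] int[of 1] by (simp add: P set_integral_diff)
  also have "\<dots> = (LBINT s:{0..1}. green t s * haar i s)"
    by (rule set_lebesgue_integral_cong) (auto simp: green_def algebra_simps)
  finally show ?thesis .
qed

text \<open>
  The function \<open>s \<mapsto> (t - s) * u1 s + u s\<close> is an antiderivative of \<open>(t - s) * u2 s\<close>, which gives Taylor's
  formula with integral remainder at \<open>0\<close>; the correction term in \<open>green\<close> cancels the unknown slope
  \<open>u1 0\<close>.
\<close>

lemma integral_green:
  fixes u u1 u2 :: "real \<Rightarrow> real"
  assumes u: "deriv_on_01 u u1" and u1: "deriv_on_01 u1 u2" and u2: "continuous_on {0..1} u2"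
    and "u 0 = 0" and t: "t \<in> {0..1}"
  shows "integral {0..1} (\<lambda>s. green t s * u2 s) = u t - t * u 1"
proof -
  have max_int: "((\<lambda>s. max 0 (r - s) * u2 s) has_integral u r - r * u1 0) {0..1}"
    if r: "r \<in> {0..1}" for r
  proof -
    have "((\<lambda>s. (r - s) * u2 s) has_integral
        ((r - r) * u1 r + u r) - ((r - 0) * u1 0 + u 0)) {0..r}"
    proof (rule fundamental_theorem_of_calculus)
      fix x assume x: "x \<in> {0..r}"
      have "(u has_real_derivative u1 x) (at x within {0..r})"
        "(u1 has_real_derivative u2 x) (at x within {0..r})"
        using u u1 x r unfolding deriv_on_01_def
        by (auto intro!: DERIV_subset[of _ _ _ "{0..1}" "{0..r}"])
      then show "((\<lambda>s. (r - s) * u1 s + u s) has_vector_derivative (r - x) * u2 x)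
          (at x within {0..r})"
        unfolding has_real_derivative_iff_has_vector_derivative[symmetric]
        by (auto intro!: derivative_eq_intros)
    qed (use r in auto)
    then have "((\<lambda>s. max 0 (r - s) * u2 s) has_integral u r - r * u1 0) {0..r}"
      using \<open>u 0 = 0\<close> by (subst has_integral_cong[where g = "\<lambda>s. (r - s) * u2 s"]) auto
    moreover have "((\<lambda>s. max 0 (r - s) * u2 s) has_integral 0) {r..1}"
      by (rule has_integral_is_0) auto
    ultimately show ?thesis
      using has_integral_combine[of 0 r 1] r by fastforce
  qed
  have "((\<lambda>s. max 0 (t - s) * u2 s - t * (max 0 (1 - s) * u2 s)) has_integral
      (u t - t * u1 0) - t * (u 1 - 1 * u1 0)) {0..1}"
    using t by (intro has_integral_diff has_integral_mult_right max_int) auto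
  then have "((\<lambda>s. green t s * u2 s) has_integral u t - t * u 1) {0..1}"
    by (subst has_integral_cong[where g = "\<lambda>s. max 0 (t - s) * u2 s - t * (max 0 (1 - s) * u2 s)"])
      (auto simp: green_def algebra_simps)
  then show ?thesis
    by (rule integral_unique)
qed

lemma deriv_on_01_lipschitz:
  assumes "deriv_on_01 f f'" "\<And>t. t \<in> {0..1} \<Longrightarrow> \<bar>f' t\<bar> \<le> B" "B \<ge> 0"
  shows "B-lipschitz_on {0..1} f"
proof (rule lipschitz_onI)
  fix x y :: real
  assume "x \<in> {0..1}" "y \<in> {0..1}"
  then have "norm (f x - f y) \<le> B * norm (x - y)"
    using assms by (intro field_differentiable_bound[of "{0..1}" f f' B x y])
      (auto simp: deriv_on_01_def)
  then show "dist (f x) (f y) \<le> B * dist x y"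
    by (simp add: dist_norm)
qed (fact assms)

text \<open>
  The sum up to \<open>2 * 2 ^ J\<close> contains all Haar functions of level at most \<open>J\<close>, and the finest of them
  have the cells of level \<open>Suc J\<close> as the halves of their supports; hence the exponent.
\<close>

lemma haar_sum_error:
  assumes u: "deriv_on_01 u u1" "deriv_on_01 u1 u2" "deriv_on_01 u2 u3"
    and bound: "\<And>t. t \<in> {0..1} \<Longrightarrow> \<bar>u3 t\<bar> \<le> B" and B: "B \<ge> 0"
    and "u 0 = 0" and t: "t \<in> {0..1}"
  shows "\<bar>haar_sum u2 (2 ^ J) t - (u t - t * u 1)\<bar> \<le> B / (2 ^ Suc J)\<^sup>2"
proof -
  have lip: "B-lipschitz_on {0..1} u2"
    using u(3) bound B by (rule deriv_on_01_lipschitz)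
  have "haar_sum u2 (2 ^ J) t
      = (\<Sum>i=1..2 ^ Suc J. haar_coeff u2 i * (LBINT s:{0..1}. green t s * haar i s))"
    unfolding haar_sum_def power_Suc
    by (rule sum.cong) (use haar_P2_eq_green[OF t] in auto)
  then show ?thesis
    using sum_haar_error[OF lip green_lipschitz[OF t], of "Suc J"]
      integral_green[OF u(1,2) lipschitz_on_continuous_on[OF lip] \<open>u 0 = 0\<close> t]
    by simp
qed

section \<open>The coupled boundary value problem\<close>

text \<open>
  Writing \<open>z v1 = (z v1 - v1 * z 1) + v1 * z 1\<close> and similarly for \<open>y v2\<close> turns the boundary conditions
  into a linear system for \<open>y 1\<close> and \<open>z 1\<close> with determinant \<open>1 - n1 * n2 * v1 * v2\<close>.
\<close>

lemma four_point_boundary_values: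
  fixes n1 n2 v1 v2 :: real
  assumes "four_point_bc n1 n2 v1 v2 y z" and "n1 * n2 * v1 * v2 \<noteq> 1"
  shows "y 1 = n1 / (1 - n1 * n2 * v1 * v2) * (n2 * v1 * (y v2 - v2 * y 1) + (z v1 - v1 * z 1))"
    and "z 1 = n2 / (1 - n1 * n2 * v1 * v2) * ((y v2 - v2 * y 1) + v2 * n1 * (z v1 - v1 * z 1))"
proof -
  have bc: "y 1 = n1 * z v1" "z 1 = n2 * y v2"
    using assms(1) by (auto simp: four_point_bc_def)
  show "y 1 = n1 / (1 - n1 * n2 * v1 * v2) * (n2 * v1 * (y v2 - v2 * y 1) + (z v1 - v1 * z 1))"
    "z 1 = n2 / (1 - n1 * n2 * v1 * v2) * ((y v2 - v2 * y 1) + v2 * n1 * (z v1 - v1 * z 1))"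
    unfolding bc using assms(2) by (auto simp: field_simps)
qed

text \<open>
  If the square of \<open>f\<close> is not integrable, its Bochner integral is \<open>0\<close> and the bound holds trivially.
\<close>

lemma L2_norm_01_le_bound:
  assumes "\<And>t. t \<in> {0..1} \<Longrightarrow> \<bar>f t\<bar> \<le> c"
  shows "L2_norm_01 f \<le> c"
proof -
  have c: "c \<ge> 0"
    using assms[of 0] by simp
  have "(LBINT t:{0..1}. (f t)\<^sup>2) \<le> c\<^sup>2"
  proof (cases "set_integrable lborel {0..1} (\<lambda>t. (f t)\<^sup>2)")
    case True
    have "(LBINT t:{0..1}. (f t)\<^sup>2) \<le> (LBINT t:{0..1::real}. c\<^sup>2)"
      by (rule set_integral_mono[OF True])
        (use assms c in \<open>auto simp: abs_le_square_iff[symmetric] intro!: borel_integrable_atLeastAtMost'\<close>)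
    then show ?thesis
      by (simp add: set_lebesgue_integral_def)
  next
    case False
    then show ?thesis
      by (simp add: set_integrable_def set_lebesgue_integral_def not_integrable_integral_eq)
  qed
  then show ?thesis
    unfolding L2_norm_01_def using c by (intro real_le_lsqrt) auto
qed

text \<open>
  The expression on the left is the common shape of the errors of \<open>truncated_y\<close> and \<open>truncated_z\<close>:
  \<open>a\<close>, \<open>b\<close> and \<open>c\<close> stand for the errors of the Haar sums at \<open>v2\<close>, at \<open>v1\<close> and at \<open>t\<close>.
\<close>

lemma coupled_error_bound:
  fixes p q r :: real
  assumes "\<bar>a\<bar> \<le> A" "\<bar>b\<bar> \<le> B" "\<bar>c\<bar> \<le> A'" "p \<ge> 0" "q \<ge> 0" "r \<ge> 0" "t \<in> {0..1}"
  shows "\<bar>p * t * (q * a + r * b) + c\<bar> \<le> p * (q * A + r * B) + A'"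
proof -
  have "\<bar>q * a + r * b\<bar> \<le> q * A + r * B"
    using assms by (intro order_trans[OF abs_triangle_ineq] add_mono) (auto simp: abs_mult mult_left_mono)
  moreover have "\<bar>p * t\<bar> \<le> p"
    using assms by (auto simp: abs_mult mult_left_le)
  ultimately have "\<bar>p * t * (q * a + r * b)\<bar> \<le> p * (q * A + r * B)"
    unfolding abs_mult[of "p * t"] using assms by (intro mult_mono) auto
  then show ?thesis
    using assms by linarith
qed

lemma threshold_level_imp_less:
  assumes "C > 0" "\<epsilon> > 0" "real J > log 2 (sqrt (2 * C / \<epsilon>)) - 1"
  shows "C / (2 ^ Suc J)\<^sup>2 < \<epsilon>"
proof -
  have "log 2 (sqrt (2 * C / \<epsilon>)) < real (Suc J)"
    using assms(3) by simp
  then have "sqrt (2 * C / \<epsilon>) < 2 powr real (Suc J)"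
    using assms by (subst (asm) log_less_iff) auto
  then have "sqrt (2 * C / \<epsilon>) < 2 ^ Suc J"
    by (simp only: powr_realpow zero_less_numeral)
  then have "(sqrt (2 * C / \<epsilon>))\<^sup>2 < (2 ^ Suc J)\<^sup>2"
    using assms by (intro power_strict_mono) auto
  then have "2 * C / \<epsilon> < (2 ^ Suc J)\<^sup>2"
    using assms by simp
  then have "2 * C < \<epsilon> * (2 ^ Suc J)\<^sup>2"
    using assms(2) by (simp add: divide_less_eq mult.commute)
  then show ?thesis
    using assms(1) by (subst divide_less_eq) auto
qed

theorem theorem5p2:
  fixes n1 n2 v1 v2 xi1 xi2 :: real
  assumes "n1 \<in> {0<..<1}" "n2 \<in> {0<..<1}" "v1 \<in> {0<..<1}" "v2 \<in> {0<..<1}"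
    and "xi1 > 0" "xi2 > 0"
  shows "\<exists>C::real. C > 0 \<and>
    (\<forall>(k1::real) (k2::real) (w1::real) (w2::real)
      (f1 :: real \<Rightarrow> real \<Rightarrow> real \<Rightarrow> real) (f2 :: real \<Rightarrow> real \<Rightarrow> real \<Rightarrow> real)
      (y :: real \<Rightarrow> real) (y1 :: real \<Rightarrow> real) (y2 :: real \<Rightarrow> real) (y3 :: real \<Rightarrow> real)
      (z :: real \<Rightarrow> real) (z1 :: real \<Rightarrow> real) (z2 :: real \<Rightarrow> real) (z3 :: real \<Rightarrow> real)
      (\<epsilon>::real) (J::nat) (M::nat).
      0 \<le> k1 \<longrightarrow> k1 < 1 \<longrightarrow> 0 \<le> k2 \<longrightarrow> w1 < 1 \<longrightarrow> w2 < 1 \<longrightarrow>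
      deriv_on_01 y y1 \<longrightarrow> deriv_on_01 y1 y2 \<longrightarrow> deriv_on_01 y2 y3 \<longrightarrow>
      deriv_on_01 z z1 \<longrightarrow> deriv_on_01 z1 z2 \<longrightarrow> deriv_on_01 z2 z3 \<longrightarrow>
      lane_emden_on k1 w1 (\<lambda>t. f1 t (y t) (z t)) y1 \<longrightarrow>
      lane_emden_on k2 w2 (\<lambda>t. f2 t (y t) (z t)) z1 \<longrightarrow>
      four_point_bc n1 n2 v1 v2 y z \<longrightarrow>
      in_L2_01 y3 \<longrightarrow> in_L2_01 z3 \<longrightarrow>
      continuous_on {0..1} y3 \<longrightarrow> continuous_on {0..1} z3 \<longrightarrow>
      (\<forall>t\<in>{0..1}. \<bar>y3 t\<bar> \<le> xi1) \<longrightarrow> (\<forall>t\<in>{0..1}. \<bar>z3 t\<bar> \<le> xi2) \<longrightarrow>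
      \<epsilon> > 0 \<longrightarrow> M = 2 ^ J \<longrightarrow>
      real J > log 2 (sqrt (2 * C / \<epsilon>)) - 1 \<longrightarrow>
      L2_norm_01 (\<lambda>t. truncated_y n1 n2 v1 v2 y2 z2 M t - y t)
        + L2_norm_01 (\<lambda>t. truncated_z n1 n2 v1 v2 y2 z2 M t - z t) < \<epsilon>)"
proof -
  define q where "q = 1 - n1 * n2 * v1 * v2"
  \<comment> \<open>\<open>D1 * h\<^sup>2\<close> and \<open>D2 * h\<^sup>2\<close> bound the errors of the two components when each Haar sum is off by
    \<open>xi1 * h\<^sup>2\<close> or \<open>xi2 * h\<^sup>2\<close>; the factors \<open>1\<close> match the shape of \<open>coupled_error_bound\<close>.\<close>
  define D1 where "D1 = n1 / q * (n2 * v1 * xi1 + 1 * xi2) + xi1"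
  define D2 where "D2 = n2 / q * (1 * xi1 + v2 * n1 * xi2) + xi2"
  have pos: "n1 > 0" "n2 > 0" "v1 > 0" "v2 > 0"
    using assms by auto
  have "n1 * n2 < 1" "v1 * v2 < 1"
    using assms mult_strict_mono[of n1 1 n2 1] mult_strict_mono[of v1 1 v2 1] by auto
  then have "(n1 * n2) * (v1 * v2) < 1"
    using pos mult_strict_mono[of "n1 * n2" 1 "v1 * v2" 1] by auto
  then have q: "q > 0"
    by (simp add: q_def mult.assoc)
  have C: "D1 + D2 > 0"
    unfolding D1_def D2_def using pos q assms(5,6)
    by (intro add_pos_pos mult_pos_pos divide_pos_pos) auto
  show ?thesis
  proof (intro exI[of _ "D1 + D2"] conjI allI impI)
    fix y y1 y2 y3 z z1 z2 z3 :: "real \<Rightarrow> real" and \<epsilon> :: real and J M :: nat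
    assume y: "deriv_on_01 y y1" "deriv_on_01 y1 y2" "deriv_on_01 y2 y3"
      and z: "deriv_on_01 z z1" "deriv_on_01 z1 z2" "deriv_on_01 z2 z3"
      and bc: "four_point_bc n1 n2 v1 v2 y z"
      and y3: "\<forall>t\<in>{0..1}. \<bar>y3 t\<bar> \<le> xi1" and z3: "\<forall>t\<in>{0..1}. \<bar>z3 t\<bar> \<le> xi2"
      and eps: "\<epsilon> > 0" and M: "M = 2 ^ J"
      and J: "real J > log 2 (sqrt (2 * (D1 + D2) / \<epsilon>)) - 1"
    define N :: real where "N = (2 ^ Suc J)\<^sup>2"
    define dy where "dy t = haar_sum y2 M t - (y t - t * y 1)" for t
    define dz where "dz t = haar_sum z2 M t - (z t - t * z 1)" for t
    have dy: "\<bar>dy t\<bar> \<le> xi1 / N" and dz: "\<bar>dz t\<bar> \<le> xi2 / N" if "t \<in> {0..1}" for t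
      using haar_sum_error[OF y, of xi1 t J] haar_sum_error[OF z, of xi2 t J] that bc y3 z3 assms(5,6)
      by (auto simp: dy_def dz_def M N_def four_point_bc_def)
    have v: "v1 \<in> {0..1}" "v2 \<in> {0..1}"
      using assms by auto
    note bv = four_point_boundary_values[OF bc, folded q_def]
    have Ey: "truncated_y n1 n2 v1 v2 y2 z2 M t - y t
        = n1 / q * t * (n2 * v1 * dy v2 + 1 * dz v1) + dy t" for t
    proof -
      have "truncated_y n1 n2 v1 v2 y2 z2 M t
          = n1 / q * t * (n2 * v1 * haar_sum y2 M v2 + haar_sum z2 M v1) + haar_sum y2 M t"
        by (simp add: truncated_y_def q_def)
      moreover have "y t = t * (n1 / q * (n2 * v1 * (y v2 - v2 * y 1) + (z v1 - v1 * z 1)))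
          + (y t - t * y 1)"
        using bv(1) q by (simp add: q_def)
      ultimately show ?thesis
        unfolding dy_def dz_def by algebra
    qed
    have Ny: "L2_norm_01 (\<lambda>t. truncated_y n1 n2 v1 v2 y2 z2 M t - y t) \<le> D1 / N"
    proof (intro L2_norm_01_le_bound)
      fix t :: real
      assume t: "t \<in> {0..1}"
      have "\<bar>n1 / q * t * (n2 * v1 * dy v2 + 1 * dz v1) + dy t\<bar>
          \<le> n1 / q * (n2 * v1 * (xi1 / N) + 1 * (xi2 / N)) + xi1 / N"
        using pos q by (intro coupled_error_bound dy dz v t) auto
      also have "\<dots> = D1 / N"
        by (simp add: D1_def add_divide_distrib distrib_left)
      finally show "\<bar>truncated_y n1 n2 v1 v2 y2 z2 M t - y t\<bar> \<le> D1 / N"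
        unfolding Ey .
    qed
    have Ez: "truncated_z n1 n2 v1 v2 y2 z2 M t - z t
        = n2 / q * t * (1 * dy v2 + v2 * n1 * dz v1) + dz t" for t
    proof -
      have "truncated_z n1 n2 v1 v2 y2 z2 M t
          = n2 / q * t * (haar_sum y2 M v2 + v2 * n1 * haar_sum z2 M v1) + haar_sum z2 M t"
        by (simp add: truncated_z_def q_def)
      moreover have "z t = t * (n2 / q * ((y v2 - v2 * y 1) + v2 * n1 * (z v1 - v1 * z 1)))
          + (z t - t * z 1)"
        using bv(2) q by (simp add: q_def)
      ultimately show ?thesis
        unfolding dy_def dz_def by algebra
    qed
    have Nz: "L2_norm_01 (\<lambda>t. truncated_z n1 n2 v1 v2 y2 z2 M t - z t) \<le> D2 / N"
    proof (intro L2_norm_01_le_bound)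
      fix t :: real
      assume t: "t \<in> {0..1}"
      have "\<bar>n2 / q * t * (1 * dy v2 + v2 * n1 * dz v1) + dz t\<bar>
          \<le> n2 / q * (1 * (xi1 / N) + v2 * n1 * (xi2 / N)) + xi2 / N"
        using pos q by (intro coupled_error_bound dy dz v t) auto
      also have "\<dots> = D2 / N"
        by (simp add: D2_def add_divide_distrib distrib_left)
      finally show "\<bar>truncated_z n1 n2 v1 v2 y2 z2 M t - z t\<bar> \<le> D2 / N"
        unfolding Ez .
    qed
    have "D1 / N + D2 / N < \<epsilon>"
      using threshold_level_imp_less[OF C eps J] by (simp add: N_def add_divide_distrib)
    with Ny Nz show "L2_norm_01 (\<lambda>t. truncated_y n1 n2 v1 v2 y2 z2 M t - y t)
        + L2_norm_01 (\<lambda>t. truncated_z n1 n2 v1 v2 y2 z2 M t - z t) < \<epsilon>"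
      by linarith
  qed (fact C)
qed

end
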